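(* Let $l$ be a fixed positive integer. Then for every integer $n\ge1$, $$\left\lfloor\left(\sum_{k=n}^\infty\frac{1}{B_{lk}}\right)^{-1}\right\rfloor=B_{ln}-B_{l(n-1)}-1\qquad\text{and}\qquad\left\lfloor\left(\sum_{k=n}^\infty\frac{1}{C_{lk}}\right)^{-1}\right\rfloor=C_{ln}-C_{l(n-1)}.$$
   Context: The balancing numbers are defined by $B_0=0$, $B_1=1$, $B_n=6B_{n-1}-B_{n-2}$ for $n\ge 2$. The Lucas-balancing numbers are defined by $C_0=1$, $C_1=3$, $C_n=6C_{n-1}-C_{n-2}$ for $n\ge 2$. $\lfloor x\rfloor$ denotes the integer part (floor) of a real number $x$. *)

theory Defs imports Complex_Main
begin

(* Integer-valued, so that the differences in the theorem are not truncated. *)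
fun balancing :: "nat \<Rightarrow> int" where
  "balancing 0 = 0"
| "balancing (Suc 0) = 1"
| "balancing (Suc (Suc n)) = 6 * balancing (Suc n) - balancing n"

fun lucas_balancing :: "nat \<Rightarrow> int" where
  "lucas_balancing 0 = 1"
| "lucas_balancing (Suc 0) = 3"
| "lucas_balancing (Suc (Suc n)) = 6 * lucas_balancing (Suc n) - lucas_balancing n"

end

theory Submission imports Defs
begin

text \<open>
  Both sequences \<open>x k = B (l * k)\<close> and \<open>x k = C (l * k)\<close> satisfy \<open>x (k + 2) = p * x (k + 1) - x k\<close> with
  \<open>p = 2 * C l\<close>. Put \<open>D k = x (k + 1) - x k\<close>. By the Cassini identity
  \<open>D k * D (k + 1) = (p - 2) * (x (k + 1))\<^sup>2 + d\<close>, the difference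
  \<open>1 / (D k + c) - 1 / (D (k + 1) + c)\<close> lies below or above \<open>1 / x (k + 1)\<close> according to the sign of
  \<open>d + c * (x (k + 2) - x k) + c\<^sup>2\<close>. Telescoping then bounds the reciprocal of the
  sum from \<open>k = n\<close> on by \<open>D (n - 1) + c\<close>; the choices \<open>c = 0, -1\<close> for \<open>B\<close> and \<open>c = 0, 1\<close> for \<open>C\<close> give the two floors.
\<close>

section \<open>Second-order recurrences\<close>

text \<open>The Cassini constant \<open>d\<close> is a parameter because its sign separates the two
  instances: positive for \<open>balancing\<close>, negative for \<open>lucas_balancing\<close>. As
  \<open>x 0\<close> may be 0, reciprocals start at an index \<open>Suc m\<close>.\<close>

locale growing_recurrence =
  fixes x :: "nat \<Rightarrow> real" and p d :: real
  assumes rec: "x (Suc (Suc k)) = p * x (Suc k) - x k"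
    and p_ge: "p \<ge> 3"
    and x0: "0 \<le> x 0" and x1: "1 \<le> x 1" and x01: "x 0 < x 1"
    and cassini0: "(x 1)\<^sup>2 - x 0 * x 2 = d"
begin

definition D :: "nat \<Rightarrow> real" where "D k = x (Suc k) - x k"

lemma x_pos_mono: "1 \<le> x (Suc k) \<and> 0 \<le> x k \<and> x k < x (Suc k)"
proof (induction k)
  case 0
  then show ?case using x0 x1 x01 by simp
next
  case (Suc k)
  have "3 * x (Suc k) \<le> p * x (Suc k)" using p_ge Suc by (intro mult_right_mono) auto
  then show ?case using Suc rec[of k] by linarith
qed

lemma D_Suc: "D (Suc k) = D k + (p - 2) * x (Suc k)"
  by (simp add: D_def rec algebra_simps)

lemma D_step: "D k + 1 \<le> D (Suc k)"
proof -
  have "1 * 1 \<le> (p - 2) * x (Suc k)" using p_ge x_pos_mono[of k] by (intro mult_mono) auto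
  then show ?thesis by (simp add: D_Suc)
qed

lemma D_mono: "j \<le> k \<Longrightarrow> D j \<le> D k"
  by (rule lift_Suc_mono_le) (use D_step in \<open>smt (verit)\<close>)

text \<open>Linear growth is far below the truth, but it already forces \<open>1 / (D k + c)\<close>
  to tend to 0.\<close>

lemma D_ge: "real k \<le> D k"
proof (induction k)
  case 0
  then show ?case using x01 by (simp add: D_def)
next
  case (Suc k)
  then show ?case using D_step[of k] by simp
qed

lemma D_pos: "0 < D k"
  using x_pos_mono[of k] by (simp add: D_def)

lemma cassini: "(x (Suc k))\<^sup>2 - x k * x (Suc (Suc k)) = d"
proof (induction k)
  case 0
  then show ?case using cassini0 by (simp add: numeral_2_eq_2)
next
  case (Suc k)
  then show ?case by (simp add: rec power2_eq_square algebra_simps)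
qed

lemma D_mult: "D k * D (Suc k) = (p - 2) * (x (Suc k))\<^sup>2 + d"
  using cassini[of k] by (simp add: D_def rec power2_eq_square algebra_simps)

section \<open>Convergence, telescoping and bounds for reciprocal sums\<close>

lemma inverse_D_tendsto: "(\<lambda>k. 1 / (D (m + k) + c)) \<longlonglongrightarrow> 0"
proof -
  have "filterlim (\<lambda>k. D (m + k) + c) at_top sequentially"
  proof (rule filterlim_at_top_mono)
    show "filterlim (\<lambda>k. c + real k) at_top sequentially"
      by (intro filterlim_tendsto_add_at_top[OF tendsto_const] filterlim_real_sequentially)
    show "\<forall>\<^sub>F k in sequentially. c + real k \<le> D (m + k) + c"
      using D_ge by (intro always_eventually) (smt (verit) of_nat_add of_nat_0_le_iff)
  qed
  from tendsto_inverse_0_at_top[OF this] show ?thesis by (simp add: inverse_eq_divide)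
qed

lemma summable_reciprocals: "summable (\<lambda>k. 1 / x (Suc m + k))"
proof (rule summable_ratio_test[of "1/2" 0])
  fix k
  have pos: "1 \<le> x (Suc (m + k))" "x (m + k) < x (Suc (m + k))"
    using x_pos_mono[of "m + k"] by auto
  \<comment> \<open>Three times a term, less its smaller predecessor, is at least twice that term;
    hence the ratio 1/2.\<close>
  have "3 * x (Suc (m + k)) \<le> p * x (Suc (m + k))"
    using p_ge pos by (intro mult_right_mono) auto
  then have "2 * x (Suc (m + k)) \<le> x (Suc (Suc (m + k)))"
    using rec[of "m + k"] pos by linarith
  then show "norm (1 / x (Suc m + Suc k)) \<le> 1/2 * norm (1 / x (Suc m + k))"
    using pos by (simp add: field_simps)
qed simp

lemma telescope:
  "(\<lambda>k. 1 / (D (m + k) + c) - 1 / (D (Suc (m + k)) + c)) sums (1 / (D m + c))"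
  using telescope_sums'[OF inverse_D_tendsto[of m c]] by simp

lemma reciprocal_sum_pos: "0 < (\<Sum>k. 1 / x (Suc m + k))"
proof (rule suminf_pos[OF summable_reciprocals])
  show "0 < 1 / x (Suc m + k)" for k
    using x_pos_mono[of "m + k"] by simp
qed

text \<open>Over the common denominator, \<open>D_mult\<close> and \<open>D_Suc\<close> cancel the
  multiples of \<open>(x (Suc m))\<^sup>2\<close>. What multiplies \<open>c\<close> is
  \<open>D m + D (Suc m)\<close>, which collapses to \<open>x (Suc (Suc m)) - x m\<close>.\<close>

lemma term_difference:
  assumes "0 < D m + c"
  shows "1 / x (Suc m) - (1 / (D m + c) - 1 / (D (Suc m) + c))
    = (d + c * (x (Suc (Suc m)) - x m) + c\<^sup>2) / (x (Suc m) * (D m + c) * (D (Suc m) + c))"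
proof -
  have nz: "x (Suc m) \<noteq> 0" "D m + c \<noteq> 0" "D (Suc m) + c \<noteq> 0"
    using x_pos_mono[of m] assms D_step[of m] by auto
  have "(D m + c) * (D (Suc m) + c) - x (Suc m) * (D (Suc m) - D m)
      = d + c * (x (Suc (Suc m)) - x m) + c\<^sup>2"
    using D_mult[of m] D_Suc[of m] unfolding D_def by algebra
  moreover have "1 / x (Suc m) - (1 / (D m + c) - 1 / (D (Suc m) + c))
    = ((D m + c) * (D (Suc m) + c) - x (Suc m) * (D (Suc m) - D m))
      / (x (Suc m) * (D m + c) * (D (Suc m) + c))"
    using nz by (simp add: divide_simps)
  ultimately show ?thesis by simp
qed

lemma term_denominator_pos:
  assumes "0 < D m + c"
  shows "0 < x (Suc (m + k)) * (D (m + k) + c) * (D (Suc (m + k)) + c)"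
  using assms D_mono[of m "m + k"] D_step[of "m + k"] x_pos_mono[of "m + k"]
  by (intro mult_pos_pos) auto

lemma inverse_sum_less:
  assumes pos: "0 < D m + c"
    and e: "\<And>k. 0 < d + c * (x (Suc (Suc k)) - x k) + c\<^sup>2"
  shows "inverse (\<Sum>k. 1 / x (Suc m + k)) < D m + c"
proof -
  let ?t = "\<lambda>k. 1 / (D (m + k) + c) - 1 / (D (Suc (m + k)) + c)"
  have "?t k < 1 / x (Suc m + k)" for k
  proof -
    have "0 < D (m + k) + c" using pos D_mono[of m "m + k"] by simp
    from term_difference[OF this] term_denominator_pos[OF pos, of k] e[of "m + k"]
    have "0 < 1 / x (Suc (m + k)) - ?t k" by simp
    then show ?thesis by simp
  qed
  \<comment> \<open>Summing the differences keeps the inequality strict; comparing the two sums by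
    \<open>suminf_le\<close> would give only a weak one.\<close>
  then have "0 < (\<Sum>k. 1 / x (Suc m + k) - ?t k)"
    by (intro suminf_pos summable_diff summable_reciprocals sums_summable[OF telescope]) simp
  also have "\<dots> = (\<Sum>k. 1 / x (Suc m + k)) - 1 / (D m + c)"
    using suminf_diff[OF summable_reciprocals sums_summable[OF telescope], of m m c]
      sums_unique[OF telescope, of m c] by simp
  finally show ?thesis
    using pos reciprocal_sum_pos[of m] by (simp add: field_simps)
qed

lemma inverse_sum_ge:
  assumes pos: "0 < D m + c"
    and e: "\<And>k. d + c * (x (Suc (Suc k)) - x k) + c\<^sup>2 \<le> 0"
  shows "D m + c \<le> inverse (\<Sum>k. 1 / x (Suc m + k))"
proof -
  let ?t = "\<lambda>k. 1 / (D (m + k) + c) - 1 / (D (Suc (m + k)) + c)"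
  have "1 / x (Suc m + k) \<le> ?t k" for k
  proof -
    have "0 < D (m + k) + c" using pos D_mono[of m "m + k"] by simp
    from term_difference[OF this] term_denominator_pos[OF pos, of k] e[of "m + k"]
    have "1 / x (Suc (m + k)) - ?t k \<le> 0"
      by (simp add: divide_nonpos_pos)
    then show ?thesis by simp
  qed
  then have "(\<Sum>k. 1 / x (Suc m + k)) \<le> 1 / (D m + c)"
    using suminf_le[OF _ summable_reciprocals sums_summable[OF telescope], of m m c]
      sums_unique[OF telescope, of m c] by simp
  then show ?thesis
    using pos reciprocal_sum_pos[of m] by (simp add: field_simps)
qed

text \<open>The gap is \<open>D k + D (Suc k)\<close>, a sum of increasing terms. A lower bound at
  \<open>k = 0\<close> therefore settles the sign conditions for all \<open>k\<close>.\<close>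

lemma gap_mono: "x 2 - x 0 \<le> x (Suc (Suc k)) - x k"
  using D_mono[of 0 k] D_mono[of 1 "Suc k"] by (simp add: D_def numeral_2_eq_2)

end

section \<open>Balancing and Lucas-balancing numbers\<close>

text \<open>This is multiplication of \<open>C n + B n * sqrt 8\<close> by
  \<open>3 + sqrt 8\<close>. It turns later inductions into one-step ones, run with
  \<open>balancing_rec\<close> switched off.\<close>

lemma balancing_Suc_lucas_Suc:
  "balancing (Suc n) = 3 * balancing n + lucas_balancing n
    \<and> lucas_balancing (Suc n) = 3 * lucas_balancing n + 8 * balancing n"
  by (induction n rule: balancing.induct) auto

lemma balancing_Suc: "balancing (Suc n) = 3 * balancing n + lucas_balancing n"
  and lucas_balancing_Suc: "lucas_balancing (Suc n) = 3 * lucas_balancing n + 8 * balancing n"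
  using balancing_Suc_lucas_Suc by blast+

lemmas balancing_rec = balancing.simps(3) lucas_balancing.simps(3)

text \<open>These are the two coordinates of \<open>w^(m + n) = w^m * w^n\<close> for
  \<open>w = 3 + sqrt 8\<close>, where \<open>w^n = C n + B n * sqrt 8\<close>.\<close>

lemma balancing_lucas_add:
  "balancing (m + n) = balancing m * lucas_balancing n + lucas_balancing m * balancing n
    \<and> lucas_balancing (m + n) = lucas_balancing m * lucas_balancing n + 8 * balancing m * balancing n"
  by (induction n)
    (simp_all add: balancing_Suc lucas_balancing_Suc algebra_simps del: balancing_rec)

lemma lucas_balancing_pell: "(lucas_balancing n)\<^sup>2 - 8 * (balancing n)\<^sup>2 = 1"
  by (induction n)
    (simp_all add: balancing_Suc lucas_balancing_Suc power2_eq_square algebra_simps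
      del: balancing_rec)

lemma balancing_nonneg: "0 \<le> balancing n"
  and lucas_balancing_pos: "1 \<le> lucas_balancing n"
proof -
  have "0 \<le> balancing n \<and> 1 \<le> lucas_balancing n"
    by (induction n) (auto simp: balancing_Suc lucas_balancing_Suc simp del: balancing_rec)
  then show "0 \<le> balancing n" "1 \<le> lucas_balancing n" by auto
qed

lemma balancing_pos:
  assumes "l \<ge> 1" shows "1 \<le> balancing l"
proof -
  obtain k where "l = Suc k" using assms by (cases l) auto
  then show ?thesis
    using balancing_nonneg[of k] lucas_balancing_pos[of k] balancing_Suc[of k] by simp
qed

lemma lucas_balancing_ge3:
  assumes "l \<ge> 1" shows "3 \<le> lucas_balancing l"
proof -
  obtain k where "l = Suc k" using assms by (cases l) auto
  then show ?thesis
    using balancing_nonneg[of k] lucas_balancing_pos[of k] lucas_balancing_Suc[of k] by simp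
qed

lemma balancing_less_lucas: "balancing l < lucas_balancing l"
proof (rule power2_less_imp_less)
  show "(balancing l)\<^sup>2 < (lucas_balancing l)\<^sup>2"
    using lucas_balancing_pell[of l] zero_le_power2[of "balancing l"] by linarith
qed (use lucas_balancing_pos[of l] in simp)

text \<open>Raising the index by \<open>l\<close> multiplies by
  \<open>u = C l + B l * sqrt 8\<close>, which has trace \<open>2 * C l\<close> and, by Pell, norm
  1; so \<open>u\<^sup>2 = 2 * C l * u - 1\<close>.\<close>

lemma balancing_mult_rec:
  "balancing (l * Suc (Suc k))
    = 2 * lucas_balancing l * balancing (l * Suc k) - balancing (l * k)"
  "lucas_balancing (l * Suc (Suc k))
    = 2 * lucas_balancing l * lucas_balancing (l * Suc k) - lucas_balancing (l * k)"
proof -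
  define a where "a = l * k"
  have eq: "l * Suc k = a + l" "l * Suc (Suc k) = (a + l) + l" "l * k = a"
    by (simp_all add: a_def)
  note add = balancing_lucas_add[of a l] balancing_lucas_add[of "a + l" l]
  show "balancing (l * Suc (Suc k))
      = 2 * lucas_balancing l * balancing (l * Suc k) - balancing (l * k)"
    unfolding eq using add lucas_balancing_pell[of l] by algebra
  show "lucas_balancing (l * Suc (Suc k))
      = 2 * lucas_balancing l * lucas_balancing (l * Suc k) - lucas_balancing (l * k)"
    unfolding eq using add lucas_balancing_pell[of l] by algebra
qed

lemma balancing_growing_recurrence:
  assumes "l \<ge> 1"
  shows "growing_recurrence (\<lambda>k. real_of_int (balancing (l * k)))
    (2 * real_of_int (lucas_balancing l)) ((real_of_int (balancing l))\<^sup>2)"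
  using balancing_pos[OF assms] lucas_balancing_ge3[OF assms]
  by unfold_locales
    (simp_all add: balancing_mult_rec numeral_2_eq_2 mult_Suc_right[of l 0] del: mult_Suc_right)

lemma lucas_balancing_growing_recurrence:
  assumes "l \<ge> 1"
  shows "growing_recurrence (\<lambda>k. real_of_int (lucas_balancing (l * k)))
    (2 * real_of_int (lucas_balancing l)) (1 - (real_of_int (lucas_balancing l))\<^sup>2)"
  using lucas_balancing_ge3[OF assms]
  by unfold_locales
    (simp_all add: balancing_mult_rec numeral_2_eq_2 mult_Suc_right[of l 0] power2_eq_square
      algebra_simps del: mult_Suc_right)

section \<open>The two floor evaluations\<close>

lemma balancing_floor:
  assumes l: "l \<ge> 1"
  shows "summable (\<lambda>k. 1 / real_of_int (balancing (l * (Suc m + k))))"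
    and "\<lfloor>inverse (\<Sum>k. 1 / real_of_int (balancing (l * (Suc m + k))))\<rfloor>
      = balancing (l * Suc m) - balancing (l * m) - 1"
proof -
  define x where "x k = real_of_int (balancing (l * k))" for k
  define b where "b = real_of_int (balancing l)"
  \<comment> \<open>Here \<open>c\<close> is \<open>C l\<close>; the offset called \<open>c\<close>
    in the locale lemmas appears below as the numerals 0 and -1.\<close>
  define c where "c = real_of_int (lucas_balancing l)"
  interpret growing_recurrence x "2 * c" "b\<^sup>2"
    using balancing_growing_recurrence[OF l] unfolding x_def b_def c_def .
  let ?S = "\<Sum>k. 1 / x (Suc m + k)"
  have b: "1 \<le> b" "b + 1 \<le> c"
    using balancing_pos[OF l] balancing_less_lucas[of l] unfolding b_def c_def by linarith+
  have upper: "inverse ?S < D m"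
    using inverse_sum_less[of m 0] D_pos[of m] b by simp
  have lower: "D m - 1 \<le> inverse ?S"
  \<comment> \<open>Offset -1 needs \<open>D m - 1 > 0\<close>, which fails for
    \<open>l = 1\<close>, \<open>m = 0\<close>. In that case a nonpositive number is compared with a
    positive one.\<close>
  proof (cases "D m > 1")
    case True
    have "x 2 - x 0 = 2 * c * b"
      using rec[of 0] by (simp add: x_def b_def numeral_2_eq_2)
    \<comment> \<open>The sign condition at the smallest gap reads
      \<open>b\<^sup>2 - 2 * c * b + 1 \<le> 0\<close>; one copy of \<open>c * b\<close> absorbs
      \<open>b * b\<close>, the other absorbs 1.\<close>
    moreover have "1 + b * b \<le> 2 * (c * b)"
      using mult_right_mono[of b c b] mult_mono[of 1 c 1 b] b by linarith
    ultimately have "b\<^sup>2 + 1 \<le> x (Suc (Suc k)) - x k" for k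
      using gap_mono[of k] by (simp add: power2_eq_square)
    then show ?thesis using inverse_sum_ge[of m "-1"] True by (simp add: algebra_simps)
  next
    case False
    then show ?thesis using reciprocal_sum_pos[of m] by (simp add: order_trans[of _ 0])
  qed
  have D_int: "D m = real_of_int (balancing (l * Suc m) - balancing (l * m))"
    by (simp add: D_def x_def)
  show "summable (\<lambda>k. 1 / real_of_int (balancing (l * (Suc m + k))))"
    using summable_reciprocals[of m] unfolding x_def .
  have "\<lfloor>inverse ?S\<rfloor> = balancing (l * Suc m) - balancing (l * m) - 1"
    using upper lower unfolding D_int by (intro floor_unique) linarith+
  then show "\<lfloor>inverse (\<Sum>k. 1 / real_of_int (balancing (l * (Suc m + k))))\<rfloor>
      = balancing (l * Suc m) - balancing (l * m) - 1"
    unfolding x_def .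
qed

lemma lucas_balancing_floor:
  assumes l: "l \<ge> 1"
  shows "summable (\<lambda>k. 1 / real_of_int (lucas_balancing (l * (Suc m + k))))"
    and "\<lfloor>inverse (\<Sum>k. 1 / real_of_int (lucas_balancing (l * (Suc m + k))))\<rfloor>
      = lucas_balancing (l * Suc m) - lucas_balancing (l * m)"
proof -
  define x where "x k = real_of_int (lucas_balancing (l * k))" for k
  define c where "c = real_of_int (lucas_balancing l)"
  interpret growing_recurrence x "2 * c" "1 - c\<^sup>2"
    using lucas_balancing_growing_recurrence[OF l] unfolding x_def c_def .
  let ?S = "\<Sum>k. 1 / x (Suc m + k)"
  have c: "3 \<le> c"
    using lucas_balancing_ge3[OF l] unfolding c_def by linarith
  have c2: "9 \<le> c\<^sup>2"
    using mult_mono[of 3 c 3 c] c by (simp add: power2_eq_square)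
  have lower: "D m \<le> inverse ?S"
    using inverse_sum_ge[of m 0] D_pos[of m] c2 by simp
  have "x 2 - x 0 = 2 * c\<^sup>2 - 2"
    using rec[of 0] by (simp add: x_def c_def numeral_2_eq_2 power2_eq_square)
  then have "2 * c\<^sup>2 - 2 \<le> x (Suc (Suc k)) - x k" for k
    using gap_mono[of k] by simp
  \<comment> \<open>At the smallest gap the expression equals \<open>c\<^sup>2\<close>.\<close>
  then have "0 < 1 - c\<^sup>2 + 1 * (x (Suc (Suc k)) - x k) + 1\<^sup>2" for k
    using c2 by (smt (verit) one_power2)
  then have upper: "inverse ?S < D m + 1"
    using inverse_sum_less[of m 1] D_pos[of m] by simp
  have D_int: "D m = real_of_int (lucas_balancing (l * Suc m) - lucas_balancing (l * m))"
    by (simp add: D_def x_def)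
  show "summable (\<lambda>k. 1 / real_of_int (lucas_balancing (l * (Suc m + k))))"
    using summable_reciprocals[of m] unfolding x_def .
  have "\<lfloor>inverse ?S\<rfloor> = lucas_balancing (l * Suc m) - lucas_balancing (l * m)"
    using upper lower unfolding D_int by (intro floor_unique) linarith+
  then show "\<lfloor>inverse (\<Sum>k. 1 / real_of_int (lucas_balancing (l * (Suc m + k))))\<rfloor>
      = lucas_balancing (l * Suc m) - lucas_balancing (l * m)"
    unfolding x_def .
qed

theorem theorem4:
  fixes l n :: nat
  assumes "l \<ge> 1" and "n \<ge> 1"
  shows "summable (\<lambda>k. 1 / real_of_int (balancing (l * (n + k))))
    \<and> \<lfloor>inverse (\<Sum>k. 1 / real_of_int (balancing (l * (n + k))))\<rfloor>
        = balancing (l * n) - balancing (l * (n - 1)) - 1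
    \<and> summable (\<lambda>k. 1 / real_of_int (lucas_balancing (l * (n + k))))
    \<and> \<lfloor>inverse (\<Sum>k. 1 / real_of_int (lucas_balancing (l * (n + k))))\<rfloor>
        = lucas_balancing (l * n) - lucas_balancing (l * (n - 1))"
proof -
  \<comment> \<open>Since \<open>n\<close> is positive, \<open>n - 1\<close> is the true predecessor
    \<open>m\<close>, with no truncation.\<close>
  obtain m where n: "n = Suc m" using assms(2) by (cases n) auto
  show ?thesis
    using balancing_floor[OF assms(1), of m] lucas_balancing_floor[OF assms(1), of m]
    unfolding n diff_Suc_1 by blast
qed

end
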